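(* Let $X$ be a compact metric space and let $T:X\to X$ be a homeomorphism satisfying the (Anosov) closing property. Let $\mu$ be a $T$-invariant ergodic Borel probability measure on $X$. Let $g:X\to \operatorname{MCG}(M)$ be a locally constant $\operatorname{MCG}$-cocycle over $T$, and let $D$ be either Thurston's asymmetric metric $L$ or the Teichmüller metric $d_T$ on $\mathcal{T}(M)$. Then for each $\epsilon>0$ there exist an integer $k\ge 1$ and a periodic point $p=T^k(p)$ in $X$ such that $$\left|\lambda_D(\mu,f)-\frac{1}{k}D(f_k(p)o,o)\right|<\epsilon .$$
   Context: $M$ is an oriented closed surface of genus at least $2$; $\mathcal{S}$ is the set of isotopy classes of simple closed curves on $M$ that are not isotopically trivial; $\mathcal{T}=\mathcal{T}(M)$ is the Teichmüller space of $M$. $\operatorname{MCG}(M)=\operatorname{Homeo}^+(M)/\operatorname{Homeo}_0(M)$ is the mapping class group (isotopy classes of orientation-preserving homeomorphisms), a countable discrete group acting on $\mathcal{T}$ in the usual way. For $w\in\mathcal{T}$ and $\alpha\in\mathcal{S}$, $l_w(\alpha)$ is the minimal length of curves in the class $\alpha$ for the hyperbolic metric $w$, and $\operatorname{Ext}_w(\alpha)$ is the extremal length of $\alpha$ on $w$. With the action convention $l_{\varphi w}(\alpha)=l_w(\varphi^{-1}\alpha)$ for $\varphi\in\operatorname{MCG}(M)$, both metrics below are $\operatorname{MCG}(M)$-invariant. Thurston's asymmetric metric: $L(w,y)=\log\sup_{\alpha\in\mathcal{S}}\frac{l_y(\alpha)}{l_w(\alpha)}$. Teichmüller metric: $d_T(w,y)=\sup_{\alpha\in\mathcal{S}}\frac12\log\frac{\operatorname{Ext}_w(\alpha)}{\operatorname{Ext}_y(\alpha)}$.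 Fix a base point $o\in\mathcal{T}$. A locally constant $\operatorname{MCG}$-cocycle over $T$ is given by a locally constant map $g:X\to\operatorname{MCG}(M)$ (every point of $X$ has a neighborhood on which $g$ is constant); one sets $Z_n(x)=g(x)g(Tx)\cdots g(T^{n-1}x)$, $f_n(x)=Z_n(x)^{-1}$, and $f=f_1$. Lyapunov exponent: for an ergodic $T$-invariant Borel probability measure $\mu$, $\lambda_D(\mu,f)$ is the number such that $\lambda_D(\mu,f)=\lim_{n\to\infty}\frac1n D(f_n(x)o,o)=\lim_{n\to\infty}\frac1n D(o,Z_n(x)o)$ for $\mu$-almost every $x$ (it exists by Kingman's subadditive ergodic theorem). Closing property: a homeomorphism $T$ of a metric space $(X,d)$ satisfies the (Anosov) closing property if there exist constants $C,\gamma,\delta_0>0$ such that for any $x\in X$ and $k\in\mathbb{N}$ with $d(x,T^k(x))<\delta_0$ there exists a point $p\in X$ with $T^k(p)=p$ and $$d(T^i(x),T^i(p))\le C\,d(x,T^k(x))\,e^{-\gamma\min\{i,k-i\}}\quad\text{for every } i=0,\ldots,k.$$ *)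

theory Defs
  imports
    "HOL-Homology.Homology"
    "HOL-Probability.Probability"
begin

subsection \<open>Oriented closed surfaces\<close>

text \<open>
  The surface \<open>M\<close> is the universe of a type \<open>'m\<close>. Everything is topological: homeomorphisms,
  continuous curves, and (below) hyperbolic metrics given by their distance functions.
\<close>

definition closed_surface :: "'m::t2_space itself \<Rightarrow> bool" where
  "closed_surface _ \<longleftrightarrow>
     compact (UNIV :: 'm set) \<and> connected (UNIV :: 'm set) \<and>
     (\<forall>x::'m. \<exists>U. open U \<and> x \<in> U \<and> U homeomorphic (UNIV :: complex set))"

text \<open>An orientation is a fundamental class, i.e. a generator of \<open>H\<^sub>2(M; \<int>) \<cong> \<int>\<close>.\<close>

definition orientation_class :: "'m::topological_space chain set \<Rightarrow> bool" where
  "orientation_class c \<longleftrightarrow>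
     homology_group 2 (euclidean :: 'm topology) \<cong> integer_group \<and>
     c \<in> carrier (homology_group 2 (euclidean :: 'm topology)) \<and>
     generate (homology_group 2 (euclidean :: 'm topology)) {c}
       = carrier (homology_group 2 (euclidean :: 'm topology))"

definition simple_loop :: "(real \<Rightarrow> 'm::topological_space) \<Rightarrow> bool" where
  "simple_loop \<gamma> \<longleftrightarrow> simple_path \<gamma> \<and> pathfinish \<gamma> = pathstart \<gamma>"

text \<open>Simple closed curves are unparametrized and unoriented: they are subsets of \<open>M\<close>.\<close>

definition simple_closed_curve :: "'m::topological_space set \<Rightarrow> bool" where
  "simple_closed_curve C \<longleftrightarrow> (\<exists>\<gamma>. simple_loop \<gamma> \<and> path_image \<gamma> = C)"

text \<open>
  Riemann's definition of the genus: the largest number of pairwise disjoint simple closed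
  curves along which the surface can be cut without becoming disconnected.
\<close>

definition genus :: "'m::topological_space itself \<Rightarrow> nat" where
  "genus _ = Max {card F | F :: 'm set set.
     finite F \<and> (\<forall>C\<in>F. simple_closed_curve C) \<and> disjoint F \<and> connected (UNIV - \<Union>F)}"


subsection \<open>The mapping class group\<close>

definition self_homeo :: "('a::topological_space \<Rightarrow> 'a) \<Rightarrow> bool" where
  "self_homeo h \<longleftrightarrow> (\<exists>k. homeomorphism UNIV UNIV h k)"

definition homeo_plus :: "'m::topological_space chain set \<Rightarrow> ('m \<Rightarrow> 'm) monoid" where
  "homeo_plus c =
     \<lparr>carrier = {h. self_homeo h \<and> hom_induced 2 euclidean {} euclidean {} h c = c},
      monoid.mult = (\<circ>), one = id\<rparr>"

text \<open>The homeomorphisms isotopic to the identity.\<close>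

definition homeo_0 :: "('m::topological_space \<Rightarrow> 'm) set" where
  "homeo_0 = {h. \<exists>H :: real \<Rightarrow> 'm \<Rightarrow> 'm.
     continuous_on ({0..1} \<times> UNIV) (\<lambda>(t, x). H t x) \<and>
     (\<forall>t\<in>{0..1}. self_homeo (H t)) \<and> H 0 = id \<and> H 1 = h}"

text \<open>A mapping class is a coset, that is, a set of homeomorphisms.\<close>

definition MCG :: "'m::topological_space chain set \<Rightarrow> ('m \<Rightarrow> 'm) set monoid" where
  "MCG c = homeo_plus c Mod homeo_0"


subsection \<open>Isotopy classes of simple closed curves\<close>

definition isotopic :: "('m::topological_space set \<times> 'm set) set" where
  "isotopic = {(C, C'). \<exists>H :: real \<Rightarrow> real \<Rightarrow> 'm.
     continuous_on ({0..1} \<times> {0..1}) (\<lambda>(t, s). H t s) \<and>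
     (\<forall>t\<in>{0..1}. simple_loop (H t)) \<and> path_image (H 0) = C \<and> path_image (H 1) = C'}"

text \<open>
  A simple closed curve is trivial if it can be shrunk to a point through simple closed curves.
\<close>

definition isotopically_trivial :: "'m::topological_space set \<Rightarrow> bool" where
  "isotopically_trivial C \<longleftrightarrow> (\<exists>H :: real \<Rightarrow> real \<Rightarrow> 'm.
     continuous_on ({0..1} \<times> {0..1}) (\<lambda>(t, s). H t s) \<and>
     (\<forall>t\<in>{0..<1}. simple_loop (H t)) \<and> path_image (H 0) = C \<and> H 1 constant_on {0..1})"

definition curve_classes :: "'m::topological_space set set set" where
  "curve_classes = {C. simple_closed_curve C \<and> \<not> isotopically_trivial C} // isotopic"


subsection \<open>Hyperbolic metrics and Teichmueller space\<close>

definition hyp_dist :: "complex \<Rightarrow> complex \<Rightarrow> real" where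
  "hyp_dist z w = arcosh (1 + (cmod (z - w))\<^sup>2 / (2 * Im z * Im w))"

text \<open>Length of \<open>\<gamma>\<close> on \<open>[a, b]\<close> with respect to a distance function: supremum over partitions.\<close>

definition curve_length ::
    "('m \<Rightarrow> 'm \<Rightarrow> real) \<Rightarrow> (real \<Rightarrow> 'm) \<Rightarrow> real \<Rightarrow> real \<Rightarrow> ennreal" where
  "curve_length d \<gamma> a b =
     (SUP (n, t) \<in> {(n, t :: nat \<Rightarrow> real). mono t \<and> range t \<subseteq> {a..b}}.
        \<Sum>i<n. ennreal (d (\<gamma> (t i)) (\<gamma> (t (Suc i)))))"

definition isometric_chart ::
    "('m::topological_space \<Rightarrow> 'm \<Rightarrow> real) \<Rightarrow> 'm set \<Rightarrow> ('m \<Rightarrow> complex) \<Rightarrow> bool" where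
  "isometric_chart d U \<phi> \<longleftrightarrow>
     open U \<and> open (\<phi> ` U) \<and> \<phi> ` U \<subseteq> {z. Im z > 0} \<and>
     (\<forall>x\<in>U. \<forall>y\<in>U. d x y = hyp_dist (\<phi> x) (\<phi> y))"

text \<open>
  A hyperbolic metric is represented by its distance function: a length metric that induces the
  given topology and is locally isometric to the hyperbolic plane.
\<close>

definition hyperbolic_metric :: "('m::topological_space \<Rightarrow> 'm \<Rightarrow> real) \<Rightarrow> bool" where
  "hyperbolic_metric d \<longleftrightarrow>
     Metric_space UNIV d \<and> Metric_space.mtopology UNIV d = euclidean \<and>
     (\<forall>x. \<exists>U \<phi>. x \<in> U \<and> isometric_chart d U \<phi>) \<and>
     (\<forall>x y. ennreal (d x y) =
        (INF \<gamma> \<in> {\<gamma>. path \<gamma> \<and> pathstart \<gamma> = x \<and> pathfinish \<gamma> = y}. curve_length d \<gamma> 0 1))"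

definition push_metric :: "('m \<Rightarrow> 'm) \<Rightarrow> ('m \<Rightarrow> 'm \<Rightarrow> real) \<Rightarrow> ('m \<Rightarrow> 'm \<Rightarrow> real)" where
  "push_metric h d = (\<lambda>x y. d (inv_into UNIV h x) (inv_into UNIV h y))"

definition teich :: "('m::topological_space \<Rightarrow> 'm \<Rightarrow> real) set set" where
  "teich = {d. hyperbolic_metric d} //
     {(d, d'). hyperbolic_metric d \<and> hyperbolic_metric d' \<and> (\<exists>h\<in>homeo_0. d' = push_metric h d)}"

text \<open>
  The action by push-forward; it satisfies \<open>l\<^bsub>\<phi>w\<^esub>(\<alpha>) = l\<^bsub>w\<^esub>(\<phi>\<inverse>\<alpha>)\<close>.
\<close>

definition mcg_act ::
    "('m \<Rightarrow> 'm) set \<Rightarrow> ('m \<Rightarrow> 'm \<Rightarrow> real) set \<Rightarrow> ('m \<Rightarrow> 'm \<Rightarrow> real) set" where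
  "mcg_act \<phi> w = {push_metric h d | h d. h \<in> \<phi> \<and> d \<in> w}"


subsection \<open>Hyperbolic length and extremal length\<close>

definition loops_in :: "'m::topological_space set set \<Rightarrow> (real \<Rightarrow> 'm) set" where
  "loops_in \<alpha> = {\<gamma>. simple_loop \<gamma> \<and> path_image \<gamma> \<in> \<alpha>}"

definition metric_hyp_length ::
    "('m::topological_space \<Rightarrow> 'm \<Rightarrow> real) \<Rightarrow> 'm set set \<Rightarrow> ennreal" where
  "metric_hyp_length d \<alpha> = (INF \<gamma> \<in> loops_in \<alpha>. curve_length d \<gamma> 0 1)"

text \<open>
  The area measure of a hyperbolic metric: the Borel measure given by \<open>dx dy / y\<^sup>2\<close> in every
  isometric chart.
\<close>

definition hyp_area :: "('m::topological_space \<Rightarrow> 'm \<Rightarrow> real) \<Rightarrow> 'm measure" where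
  "hyp_area d = (THE A. sets A = sets borel \<and>
     (\<forall>U \<phi> B. isometric_chart d U \<phi> \<longrightarrow> B \<in> sets borel \<longrightarrow> B \<subseteq> U \<longrightarrow>
        emeasure A B = (\<integral>\<^sup>+ z \<in> \<phi> ` B. ennreal (1 / (Im z)\<^sup>2) \<partial>lborel)))"

text \<open>
  For a rectifiable curve, \<open>\<integral>\<^sub>\<gamma> \<rho> ds\<close> is the Stieltjes integral of \<open>\<rho> \<circ> \<gamma>\<close> with respect to the arc
  length function, which is extended to be constant outside of \<open>[0, 1]\<close>.
\<close>

definition line_integral ::
    "('m \<Rightarrow> 'm \<Rightarrow> real) \<Rightarrow> ('m \<Rightarrow> ennreal) \<Rightarrow> (real \<Rightarrow> 'm) \<Rightarrow> ennreal" where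
  "line_integral d \<rho> \<gamma> =
     (\<integral>\<^sup>+ t \<in> {0..1}. \<rho> (\<gamma> t)
        \<partial>(interval_measure (\<lambda>t. enn2real (curve_length d \<gamma> 0 (max 0 (min 1 t))))))"

text \<open>
  The analytic definition of extremal length,
  \<open>sup\<^sub>\<rho> (inf\<^sub>\<gamma> \<integral>\<^sub>\<gamma> \<rho> ds)\<^sup>2 / \<integral> \<rho>\<^sup>2 dA\<close>. The competing conformal metrics are written as \<open>\<rho> ds\<close>,
  a Borel multiple of the line element \<open>ds\<close> of the hyperbolic metric \<open>d\<close>.
\<close>

definition metric_ext_length ::
    "('m::topological_space \<Rightarrow> 'm \<Rightarrow> real) \<Rightarrow> 'm set set \<Rightarrow> ennreal" where
  "metric_ext_length d \<alpha> =
     (SUP \<rho> \<in> {\<rho> \<in> borel_measurable borel.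
                0 < (\<integral>\<^sup>+ x. (\<rho> x)\<^sup>2 \<partial>hyp_area d) \<and> (\<integral>\<^sup>+ x. (\<rho> x)\<^sup>2 \<partial>hyp_area d) < \<infinity>}.
        (INF \<gamma> \<in> {\<gamma> \<in> loops_in \<alpha>. curve_length d \<gamma> 0 1 < \<infinity>}. line_integral d \<rho> \<gamma>)\<^sup>2
          / (\<integral>\<^sup>+ x. (\<rho> x)\<^sup>2 \<partial>hyp_area d))"

text \<open>
  Both quantities are constant on the points of \<open>teich\<close>, and positive and finite on
  \<open>curve_classes\<close>.
\<close>

definition hyp_length ::
    "('m::topological_space \<Rightarrow> 'm \<Rightarrow> real) set \<Rightarrow> 'm set set \<Rightarrow> real" where
  "hyp_length w \<alpha> = enn2real (the_elem ((\<lambda>d. metric_hyp_length d \<alpha>) ` w))"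

definition ext_length ::
    "('m::topological_space \<Rightarrow> 'm \<Rightarrow> real) set \<Rightarrow> 'm set set \<Rightarrow> real" where
  "ext_length w \<alpha> = enn2real (the_elem ((\<lambda>d. metric_ext_length d \<alpha>) ` w))"

definition thurston_metric ::
    "('m::topological_space \<Rightarrow> 'm \<Rightarrow> real) set \<Rightarrow> ('m \<Rightarrow> 'm \<Rightarrow> real) set \<Rightarrow> real" where
  "thurston_metric w y = ln (SUP \<alpha> \<in> curve_classes. hyp_length y \<alpha> / hyp_length w \<alpha>)"

definition teichmueller_metric ::
    "('m::topological_space \<Rightarrow> 'm \<Rightarrow> real) set \<Rightarrow> ('m \<Rightarrow> 'm \<Rightarrow> real) set \<Rightarrow> real" where
  "teichmueller_metric w y =
     (SUP \<alpha> \<in> curve_classes. 1 / 2 * ln (ext_length w \<alpha> / ext_length y \<alpha>))"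


subsection \<open>Dynamics and cocycles\<close>

definition closing_property :: "('x::metric_space \<Rightarrow> 'x) \<Rightarrow> bool" where
  "closing_property T \<longleftrightarrow>
     (\<exists>C>0. \<exists>\<gamma>>0. \<exists>\<delta>\<^sub>0>0. \<forall>x. \<forall>k::nat. dist x ((T ^^ k) x) < \<delta>\<^sub>0 \<longrightarrow>
        (\<exists>p. (T ^^ k) p = p \<and>
          (\<forall>i\<le>k. dist ((T ^^ i) x) ((T ^^ i) p)
                  \<le> C * dist x ((T ^^ k) x) * exp (- \<gamma> * real (min i (k - i))))))"

definition ergodic_invariant_prob :: "('x::topological_space \<Rightarrow> 'x) \<Rightarrow> 'x measure \<Rightarrow> bool" where
  "ergodic_invariant_prob T \<mu> \<longleftrightarrow>
     prob_space \<mu> \<and> sets \<mu> = sets borel \<and> T \<in> \<mu> \<rightarrow>\<^sub>M \<mu> \<and> distr \<mu> \<mu> T = \<mu> \<and>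
     (\<forall>A\<in>sets \<mu>. T -` A = A \<longrightarrow> measure \<mu> A = 0 \<or> measure \<mu> A = 1)"

definition locally_constant :: "('x::topological_space \<Rightarrow> 'b) \<Rightarrow> bool" where
  "locally_constant g \<longleftrightarrow> (\<forall>x. \<exists>U. open U \<and> x \<in> U \<and> g constant_on U)"

primrec cocycle_Z ::
    "'g monoid \<Rightarrow> ('x \<Rightarrow> 'x) \<Rightarrow> ('x \<Rightarrow> 'g) \<Rightarrow> nat \<Rightarrow> 'x \<Rightarrow> 'g" where
  "cocycle_Z G T g 0 x = \<one>\<^bsub>G\<^esub>"
| "cocycle_Z G T g (Suc n) x = cocycle_Z G T g n x \<otimes>\<^bsub>G\<^esub> g ((T ^^ n) x)"

definition cocycle_f ::
    "'g monoid \<Rightarrow> ('x \<Rightarrow> 'x) \<Rightarrow> ('x \<Rightarrow> 'g) \<Rightarrow> nat \<Rightarrow> 'x \<Rightarrow> 'g" where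
  "cocycle_f G T g n x = inv\<^bsub>G\<^esub> (cocycle_Z G T g n x)"

text \<open>
  The number \<open>\<lambda>\<^sub>D(\<mu>, f)\<close> is determined by its defining property, stated here as a predicate. By
  invariance of \<open>D\<close>, \<open>D(f\<^sub>n(x)o, o) = D(o, Z\<^sub>n(x)o)\<close>.
\<close>

definition is_lyapunov_exponent ::
    "(('m::topological_space \<Rightarrow> 'm \<Rightarrow> real) set \<Rightarrow> ('m \<Rightarrow> 'm \<Rightarrow> real) set \<Rightarrow> real) \<Rightarrow>
     ('m \<Rightarrow> 'm \<Rightarrow> real) set \<Rightarrow> 'x measure \<Rightarrow> (nat \<Rightarrow> 'x \<Rightarrow> ('m \<Rightarrow> 'm) set) \<Rightarrow> real \<Rightarrow> bool" where
  "is_lyapunov_exponent D b \<mu> f \<Lambda> \<longleftrightarrow>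
     (AE x in \<mu>. (\<lambda>n. D (mcg_act (f n x) b) b / real n) \<longlonglongrightarrow> \<Lambda>)"

end

(* A locally constant map on a compact space is constant at some uniform scale. Hence the periodic
   point p that closes a long, sufficiently precise return x, ..., T^k x sees exactly the same values
   of g as x does, so f_k(p) = f_k(x). By Poincare recurrence almost every x returns close to itself
   at arbitrarily large times, and along these times D(f_k(x) o, o) / k tends to the exponent. *)

theory Submission
  imports Defs
begin

text \<open>The scale is a Lebesgue number for the cover of the compact space by the open sets on
  which \<open>g\<close> is constant: a ball of that radius lies inside a single such set.\<close>

lemma locally_constant_uniform:
  fixes g :: "'x::metric_space \<Rightarrow> 'b"
  assumes "compact (UNIV :: 'x set)" and "locally_constant g"
  obtains \<delta> where "\<delta> > 0" and "\<And>x y. dist x y < \<delta> \<Longrightarrow> g x = g y"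
proof -
  let ?\<U> = "{U. open U \<and> g constant_on U}"
  have "UNIV \<subseteq> \<Union>?\<U>"
    using assms(2) by (auto simp: locally_constant_def)
  then obtain e where "e > 0" and e: "\<And>x. \<exists>U\<in>?\<U>. ball x e \<subseteq> U"
    by (rule Heine_Borel_lemma[OF assms(1), of ?\<U>]) simp_all
  have "g x = g y" if "dist x y < e" for x y
  proof -
    obtain U where U: "U \<in> ?\<U>" "ball x e \<subseteq> U"
      using e by blast
    then have "x \<in> U" "y \<in> U"
      using that \<open>e > 0\<close> by auto
    then show ?thesis
      using U(1) by (auto simp: constant_on_def)
  qed
  with \<open>e > 0\<close> that show ?thesis by blast
qed

lemma measure_vimage_invariant:
  assumes "T \<in> M \<rightarrow>\<^sub>M M" and "distr M M T = M" and "A \<in> sets M"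
  shows "measure M (T -` A \<inter> space M) = measure M A"
  using measure_distr[OF assms(1,3)] assms(2) by simp

text \<open>Visiting \<open>A\<close> at some time at least \<open>n + 1\<close> means that the
  image under \<open>T\<close> visits \<open>A\<close> at some time at least \<open>n\<close>. By
  invariance these sets of visitors all have the same measure, and since they are nested and the
  measure is finite, they differ only by null sets.\<close>

lemma (in finite_measure) Poincare_recurrence:
  assumes T: "T \<in> M \<rightarrow>\<^sub>M M" "distr M M T = M" and A: "A \<in> sets M"
  shows "AE x in M. x \<in> A \<longrightarrow> (\<exists>\<^sub>\<infinity>k. (T ^^ k) x \<in> A)"
proof -
  \<comment> \<open>\<open>U n\<close> collects the points whose orbit meets \<open>A\<close> at
    some time \<open>n\<close> or later.\<close>
  define U where "U n = (\<Union>k\<in>{n..}. (T ^^ k) -` A \<inter> space M)" for n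
  have Tk: "(T ^^ k) \<in> M \<rightarrow>\<^sub>M M" for k
    using T(1) by (rule measurable_compose_n)
  have U_sets [measurable]: "U n \<in> sets M" for n
    unfolding U_def using Tk A by (intro sets.countable_UN'') (auto intro: measurable_sets)
  have U_Suc: "U (Suc n) = T -` U n \<inter> space M" for n
  proof (intro equalityI subsetI)
    fix x assume "x \<in> U (Suc n)"
    then obtain k where "k \<ge> Suc n" "(T ^^ k) x \<in> A" "x \<in> space M"
      by (auto simp: U_def)
    \<comment> \<open>As \<open>k\<close> is positive, one iterate can be peeled off:
      \<open>(T ^^ k) x\<close> is \<open>(T ^^ (k - 1)) (T x)\<close>.\<close>
    then have "k - 1 \<ge> n" "(T ^^ (k - 1)) (T x) \<in> A" "T x \<in> space M"
      using T(1)[THEN measurable_space] by (auto simp: Suc_le_eq dest!: less_imp_Suc_add simp: funpow_swap1)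
    then show "x \<in> T -` U n \<inter> space M"
      using \<open>x \<in> space M\<close> by (auto simp: U_def)
  next
    fix x assume "x \<in> T -` U n \<inter> space M"
    then obtain k where "k \<ge> n" "(T ^^ k) (T x) \<in> A" "x \<in> space M"
      by (auto simp: U_def)
    then show "x \<in> U (Suc n)"
      by (auto simp: U_def funpow_swap1 intro!: bexI[of _ "Suc k"])
  qed
  have "measure M (U n) = measure M (U 0)" for n
    by (induction n) (simp_all add: U_Suc measure_vimage_invariant[OF T U_sets])
  moreover have "U n \<subseteq> U 0" for n
    by (auto simp: U_def)
  ultimately have "measure M (U 0 - U n) = 0" for n
    using finite_measure_Diff[OF U_sets[of 0] U_sets[of n]] by (metis diff_self)
  then have "U 0 - U n \<in> null_sets M" for n
    by (simp add: null_setsI emeasure_eq_measure)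
  then have "AE x in M. \<forall>n. x \<notin> U 0 - U n"
    unfolding AE_all_countable by (intro allI AE_not_in)
  then show ?thesis
  proof (rule AE_mp, intro AE_I2 impI)
    fix x assume x: "x \<in> space M" "\<forall>n. x \<notin> U 0 - U n" "x \<in> A"
    \<comment> \<open>Time 0 counts as a visit, so every point of \<open>A\<close> is in
      \<open>U 0\<close>, hence in all \<open>U n\<close> off the null set.\<close>
    then have "x \<in> U 0"
      unfolding U_def by (intro UN_I[of 0]) auto
    then have "\<forall>n. \<exists>k\<ge>n. (T ^^ k) x \<in> A"
      using x(2) by (auto simp: U_def)
    then show "\<exists>\<^sub>\<infinity>k. (T ^^ k) x \<in> A"
      by (simp add: INFM_nat_le)
  qed
qed

text \<open>Cover the space by finitely many balls of radius \<open>\<eta> / 2\<close> and apply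
  recurrence to each. Almost every point returns infinitely often to a ball containing it, and two
  points of one ball are less than \<open>\<eta>\<close> apart.\<close>

lemma Poincare_recurrence_compact:
  fixes T :: "'x::metric_space \<Rightarrow> 'x"
  assumes "finite_measure M" and "compact (UNIV :: 'x set)" and M: "sets M = sets borel"
    and T: "T \<in> M \<rightarrow>\<^sub>M M" "distr M M T = M"
    and "\<eta> > 0"
  shows "AE x in M. \<exists>\<^sub>\<infinity>k. dist x ((T ^^ k) x) < \<eta>"
proof -
  interpret finite_measure M
    by (rule assms(1))
  obtain F where F: "finite F" "UNIV \<subseteq> (\<Union>a\<in>F. ball a (\<eta> / 2) :: 'x set)"
  proof (rule compactE_image[OF assms(2), of UNIV "\<lambda>a. ball a (\<eta> / 2)"])
    show "UNIV \<subseteq> (\<Union>a. ball a (\<eta> / 2) :: 'x set)"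
      using \<open>\<eta> > 0\<close> by auto
  qed auto
  have "AE x in M. \<forall>a\<in>F. x \<in> ball a (\<eta> / 2) \<longrightarrow> (\<exists>\<^sub>\<infinity>k. (T ^^ k) x \<in> ball a (\<eta> / 2))"
    using F(1) by (intro AE_finite_allI Poincare_recurrence[OF T]) (simp_all add: M)
  then show ?thesis
  proof (rule AE_mp, intro AE_I2 impI)
    fix x
    assume rec: "\<forall>a\<in>F. x \<in> ball a (\<eta> / 2) \<longrightarrow> (\<exists>\<^sub>\<infinity>k. (T ^^ k) x \<in> ball a (\<eta> / 2))"
    obtain a where a: "a \<in> F" "x \<in> ball a (\<eta> / 2)"
      using F(2) by blast
    have "dist x y < \<eta>" if "y \<in> ball a (\<eta> / 2)" for y
      using a(2) that by (auto intro: dist_triangle_half_r)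
    with rec a show "\<exists>\<^sub>\<infinity>k. dist x ((T ^^ k) x) < \<eta>"
      by (blast intro: INFM_mono)
  qed
qed

lemma cocycle_Z_cong:
  assumes "\<And>i. i < n \<Longrightarrow> g ((T ^^ i) x) = g ((T ^^ i) y)"
  shows "cocycle_Z G T g n x = cocycle_Z G T g n y"
  using assms by (induction n) auto

lemma closing_property_cocycle_f:
  fixes T :: "'x::metric_space \<Rightarrow> 'x"
  assumes "compact (UNIV :: 'x set)" and "closing_property T" and "locally_constant g"
  shows "\<exists>\<eta>>0. \<forall>x k. dist x ((T ^^ k) x) < \<eta> \<longrightarrow>
           (\<exists>p. (T ^^ k) p = p \<and> cocycle_f G T g k p = cocycle_f G T g k x)"
proof -
  obtain \<delta> where "\<delta> > 0" and \<delta>: "\<And>x y. dist x y < \<delta> \<Longrightarrow> g x = g y"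
    using locally_constant_uniform[OF assms(1,3)] by blast
  obtain C \<gamma> \<delta>\<^sub>0 where pos: "C > 0" "\<gamma> > 0" "\<delta>\<^sub>0 > 0"
    and closing: "\<And>x k. dist x ((T ^^ k) x) < \<delta>\<^sub>0 \<Longrightarrow>
        \<exists>p. (T ^^ k) p = p \<and>
          (\<forall>i\<le>k. dist ((T ^^ i) x) ((T ^^ i) p)
                  \<le> C * dist x ((T ^^ k) x) * exp (- \<gamma> * real (min i (k - i))))"
    using assms(2) unfolding closing_property_def by metis
  show ?thesis
  \<comment> \<open>The bound \<open>\<delta>\<^sub>0\<close> makes the closing property applicable;
    \<open>\<delta> / C\<close> brings its estimate below the scale \<open>\<delta>\<close> at which
    \<open>g\<close> is constant.\<close>
  proof (rule exI[of _ "min \<delta>\<^sub>0 (\<delta> / C)"], intro conjI allI impI)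
    show "min \<delta>\<^sub>0 (\<delta> / C) > 0"
      using pos \<open>\<delta> > 0\<close> by simp
    fix x k
    assume small: "dist x ((T ^^ k) x) < min \<delta>\<^sub>0 (\<delta> / C)"
    then obtain p where p: "(T ^^ k) p = p"
      and shadow: "\<And>i. i \<le> k \<Longrightarrow> dist ((T ^^ i) x) ((T ^^ i) p)
            \<le> C * dist x ((T ^^ k) x) * exp (- \<gamma> * real (min i (k - i)))"
      using closing by (metis min_less_iff_conj)
    have "g ((T ^^ i) x) = g ((T ^^ i) p)" if "i < k" for i
    proof (rule \<delta>)
      have "dist ((T ^^ i) x) ((T ^^ i) p)
          \<le> C * dist x ((T ^^ k) x) * exp (- \<gamma> * real (min i (k - i)))"
        using shadow that by simp
      \<comment> \<open>The exponent is nonpositive, so the exponential factor is at most 1.\<close>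
      also have "\<dots> \<le> C * dist x ((T ^^ k) x)"
        using pos by (intro mult_right_le_one_le) auto
      also have "\<dots> < \<delta>"
        using small pos by (simp add: field_simps)
      finally show "dist ((T ^^ i) x) ((T ^^ i) p) < \<delta>" .
    qed
    \<comment> \<open>The product of length \<open>k\<close> reads \<open>g\<close> only at the
      times \<open>i < k\<close>.\<close>
    then have "cocycle_f G T g k p = cocycle_f G T g k x"
      unfolding cocycle_f_def by (metis cocycle_Z_cong)
    with p show "\<exists>p. (T ^^ k) p = p \<and> cocycle_f G T g k p = cocycle_f G T g k x"
      by blast
  qed
qed

theorem theorem2p1:
  fixes c :: "'m::t2_space chain set"
    and b :: "('m \<Rightarrow> 'm \<Rightarrow> real) set"
    and D :: "('m \<Rightarrow> 'm \<Rightarrow> real) set \<Rightarrow> ('m \<Rightarrow> 'm \<Rightarrow> real) set \<Rightarrow> real"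
    and T :: "'x::metric_space \<Rightarrow> 'x"
    and \<mu> :: "'x measure"
    and g :: "'x \<Rightarrow> ('m \<Rightarrow> 'm) set"
    and \<Lambda> :: real
  assumes "closed_surface TYPE('m)" and "orientation_class c" and "genus TYPE('m) \<ge> 2"
    and "b \<in> teich"
    and "compact (UNIV :: 'x set)"
    and "self_homeo T" and "closing_property T"
    and "ergodic_invariant_prob T \<mu>"
    and "range g \<subseteq> carrier (MCG c)" and "locally_constant g"
    and "D = thurston_metric \<or> D = teichmueller_metric"
    and "is_lyapunov_exponent D b \<mu> (cocycle_f (MCG c) T g) \<Lambda>"
  shows "\<forall>\<epsilon>>0. \<exists>k\<ge>1. \<exists>p. (T ^^ k) p = p \<and>
           \<bar>\<Lambda> - 1 / real k * D (mcg_act (cocycle_f (MCG c) T g k p) b) b\<bar> < \<epsilon>"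
proof (intro allI impI)
  fix \<epsilon> :: real
  assume "\<epsilon> > 0"
  define F where "F = cocycle_f (MCG c) T g"
  have \<mu>: "prob_space \<mu>" "sets \<mu> = sets borel" "T \<in> \<mu> \<rightarrow>\<^sub>M \<mu>" "distr \<mu> \<mu> T = \<mu>"
    using assms(8) by (auto simp: ergodic_invariant_prob_def)
  interpret prob_space \<mu>
    by (rule \<mu>(1))
  obtain \<eta> where "\<eta> > 0"
    and closing: "\<forall>x k. dist x ((T ^^ k) x) < \<eta> \<longrightarrow> (\<exists>p. (T ^^ k) p = p \<and> F k p = F k x)"
    unfolding F_def using closing_property_cocycle_f[OF assms(5,7,10), where G = "MCG c"] by blast
  have "AE x in \<mu>. (\<lambda>n. D (mcg_act (F n x) b) b / real n) \<longlonglongrightarrow> \<Lambda>"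
    using assms(12) by (simp add: is_lyapunov_exponent_def F_def)
  moreover have "AE x in \<mu>. \<exists>\<^sub>\<infinity>k. dist x ((T ^^ k) x) < \<eta>"
    using Poincare_recurrence_compact[OF finite_measure_axioms assms(5) \<mu>(2-4) \<open>\<eta> > 0\<close>] .
  ultimately have "AE x in \<mu>. (\<lambda>n. D (mcg_act (F n x) b) b / real n) \<longlonglongrightarrow> \<Lambda> \<and>
      (\<exists>\<^sub>\<infinity>k. dist x ((T ^^ k) x) < \<eta>)"
    by eventually_elim simp
  \<comment> \<open>A property that holds almost everywhere for a probability measure holds at some
    point.\<close>
  then obtain x where lim: "(\<lambda>n. D (mcg_act (F n x) b) b / real n) \<longlonglongrightarrow> \<Lambda>"
    and return: "\<exists>\<^sub>\<infinity>k. dist x ((T ^^ k) x) < \<eta>"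
    using eventually_happens'[OF ae_filter_bot] by blast
  obtain N where N: "\<And>n. n \<ge> N \<Longrightarrow> \<bar>D (mcg_act (F n x) b) b / real n - \<Lambda>\<bar> < \<epsilon>"
    using LIMSEQ_D[OF lim \<open>\<epsilon> > 0\<close>] by auto
  \<comment> \<open>\<open>N\<close> depends on \<open>x\<close>, so arbitrarily late returns are
    required. The bound 1 excludes the trivial return at time 0.\<close>
  obtain k where k: "k \<ge> max N 1" "dist x ((T ^^ k) x) < \<eta>"
    using return unfolding INFM_nat_le by blast
  obtain p where "(T ^^ k) p = p" "F k p = F k x"
    using closing k(2) by blast
  \<comment> \<open>The estimate along the orbit of \<open>x\<close> carries over to
    \<open>p\<close> because \<open>F k p = F k x\<close>.\<close>
  moreover have "\<bar>\<Lambda> - 1 / real k * D (mcg_act (F k x) b) b\<bar> < \<epsilon>"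
    using N[of k] k(1) by (simp add: abs_minus_commute)
  ultimately show "\<exists>k\<ge>1. \<exists>p. (T ^^ k) p = p \<and>
      \<bar>\<Lambda> - 1 / real k * D (mcg_act (cocycle_f (MCG c) T g k p) b) b\<bar> < \<epsilon>"
    using k(1) unfolding F_def by (metis max.bounded_iff)
qed

end
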